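(* Let $F,G_1,\dots,G_m,H_1,\dots,H_\ell\in\mathcal H^{n+1}$ and consider the quaternionic QCQP $$\inf_{\mathbf q\in\mathbb H^n}\ [\mathbf q]_1^*F[\mathbf q]_1\quad\text{s.t.}\quad[\mathbf q]_1^*G_i[\mathbf q]_1\ge0\ (i=1,\dots,m),\quad[\mathbf q]_1^*H_j[\mathbf q]_1=0\ (j=1,\dots,\ell),$$ where $[\mathbf q]_1=[1,q_1,\dots,q_n]^{\intercal}$. The first-order quaternionic moment relaxation of this problem, constructed using the reduced monomial vector $[\mathbf q]_1$, has the same optimal value as the first-order real moment relaxation of the real QCQP obtained by writing $\mathbf q=\mathbf x_1+\mathbf x_2\mathbf i+\mathbf x_3\mathbf j+\mathbf x_4\mathbf k$, $\mathbf x_s\in\mathbb R^n$.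
   Context: $\mathbb H$ is the skew field of quaternions with units $\mathbf i,\mathbf j,\mathbf k$; $\mathcal R(a)$ is the real part; $A^*$ is the conjugate transpose; $\mathcal H^{n+1}$ is the space of Hermitian $(n+1)\times(n+1)$ quaternionic matrices; $A\in\mathcal H^{n+1}$ is positive semidefinite, $A\succeq0$, if $\mathbf v^*A\mathbf v\ge0$ for all $\mathbf v\in\mathbb H^{n+1}$. Matrix indices run over $0,1,\dots,n$ (respectively $0,\dots,4n$). $\langle A,Z\rangle_{\mathbb R}=\mathcal R(\mathrm{Tr}(A^*Z))$ on $\mathcal H^{n+1}$, and $\langle\cdot,\cdot\rangle$ is the Frobenius inner product on the real symmetric matrices $\mathcal S^{4n+1}$. First-order quaternionic moment relaxation (with reduced monomial vector $[\mathbf q]_1$): $$\inf_{Z\in\mathcal H^{n+1}}\langle F,Z\rangle_{\mathbb R}\ \text{ s.t. }\ \langle G_i,Z\rangle_{\mathbb R}\ge0\ (\forall i),\ \langle H_j,Z\rangle_{\mathbb R}=0\ (\forall j),\ Z_{00}=1,\ Z\succeq0.$$ For $\boldsymbol v=[t,\mathbf x_1^{\intercal},\mathbf x_2^{\intercal},\mathbf x_3^{\intercal},\mathbf x_4^{\intercal}]^{\intercal}\in\mathbb R^{4n+1}$ put $\tau(\boldsymbol v)=\begin{bmatrix}t\\ \mathbf x_1+\mathbf x_2\mathbf i+\mathbf x_3\mathbf j+\mathbf x_4\mathbf k\end{bmatrix}\in\mathbb H^{n+1}$, and for $A\in\mathcal H^{n+1}$ let $\Gamma(A)\in\mathcal S^{4n+1}$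 be the real symmetric matrix with $\boldsymbol v^{\intercal}\Gamma(A)\boldsymbol v=\tau(\boldsymbol v)^*A\tau(\boldsymbol v)$ for all $\boldsymbol v$. The equivalent real QCQP is to minimize $\widehat{\mathbf x}^{\intercal}\Gamma(F)\widehat{\mathbf x}$ subject to $\widehat{\mathbf x}^{\intercal}\Gamma(G_i)\widehat{\mathbf x}\ge0$, $\widehat{\mathbf x}^{\intercal}\Gamma(H_j)\widehat{\mathbf x}=0$, where $\widehat{\mathbf x}=[1,\mathbf x_1^{\intercal},\mathbf x_2^{\intercal},\mathbf x_3^{\intercal},\mathbf x_4^{\intercal}]^{\intercal}$. Its first-order real moment (Shor) relaxation is $$\inf_{Y\in\mathcal S^{4n+1}}\langle\Gamma(F),Y\rangle\ \text{ s.t. }\ \langle\Gamma(G_i),Y\rangle\ge0\ (\forall i),\ \langle\Gamma(H_j),Y\rangle=0\ (\forall j),\ Y_{00}=1,\ Y\succeq0.$$ Optimal values are in $[-\infty,+\infty]$ with $\inf\varnothing=+\infty$. *)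

theory Defs
  imports "Jordan_Normal_Form.Matrix" "HOL-Library.Extended_Real"
begin

section \<open>The skew field of quaternions\<close>

text \<open>\<^term>\<open>Quat a b c d\<close> is $a + b\,\mathbf i + c\,\mathbf j + d\,\mathbf k$.\<close>

datatype quat = Quat (qRe: real) (qI: real) (qJ: real) (qK: real)

lemma quat_eq_iff: "p = q \<longleftrightarrow> qRe p = qRe q \<and> qI p = qI q \<and> qJ p = qJ q \<and> qK p = qK q"
  by (cases p; cases q) simp

instantiation quat :: real_div_algebra
begin

definition "0 = Quat 0 0 0 0"
definition "1 = Quat 1 0 0 0"
definition "p + q = Quat (qRe p + qRe q) (qI p + qI q) (qJ p + qJ q) (qK p + qK q)"
definition "p - q = Quat (qRe p - qRe q) (qI p - qI q) (qJ p - qJ q) (qK p - qK q)"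
definition "- q = Quat (- qRe q) (- qI q) (- qJ q) (- qK q)"
definition "p * q = Quat
   (qRe p * qRe q - qI p * qI q - qJ p * qJ q - qK p * qK q)
   (qRe p * qI q + qI p * qRe q + qJ p * qK q - qK p * qJ q)
   (qRe p * qJ q - qI p * qK q + qJ p * qRe q + qK p * qI q)
   (qRe p * qK q + qI p * qJ q - qJ p * qI q + qK p * qRe q)"
definition "r *\<^sub>R q = Quat (r * qRe q) (r * qI q) (r * qJ q) (r * qK q)"
definition "inverse q = (let s = (qRe q)\<^sup>2 + (qI q)\<^sup>2 + (qJ q)\<^sup>2 + (qK q)\<^sup>2
   in Quat (qRe q / s) (- qI q / s) (- qJ q / s) (- qK q / s))"
definition "p div q = p * inverse (q :: quat)"

lemmas quat_arith_defs = zero_quat_def one_quat_def plus_quat_def minus_quat_def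
  uminus_quat_def times_quat_def scaleR_quat_def

instance
proof
  fix a :: quat
  assume "a \<noteq> 0"
  define s where "s = (qRe a)\<^sup>2 + (qI a)\<^sup>2 + (qJ a)\<^sup>2 + (qK a)\<^sup>2"
  have "s \<noteq> 0"
    using \<open>a \<noteq> 0\<close> unfolding s_def
    by (auto simp: quat_eq_iff zero_quat_def add_nonneg_eq_0_iff)
  have inv: "inverse a = Quat (qRe a / s) (- qI a / s) (- qJ a / s) (- qK a / s)"
    by (simp add: inverse_quat_def s_def Let_def)
  have *: "qRe a * qRe a / s + qI a * qI a / s + qJ a * qJ a / s + qK a * qK a / s = 1"
    using \<open>s \<noteq> 0\<close> by (simp add: s_def power2_eq_square flip: add_divide_distrib)
  show "inverse a * a = 1" "a * inverse a = 1"
    using * by (simp_all add: inv times_quat_def one_quat_def mult.commute)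
next
  show "inverse (0 :: quat) = 0"
    by (simp add: inverse_quat_def zero_quat_def)
qed (simp_all add: quat_arith_defs divide_quat_def quat_eq_iff algebra_simps)

end

lemma quat_sel [simp]:
  "qRe 0 = 0" "qI 0 = 0" "qJ 0 = 0" "qK 0 = 0"
  "qRe 1 = 1" "qI 1 = 0" "qJ 1 = 0" "qK 1 = 0"
  "qRe (p + q) = qRe p + qRe q" "qI (p + q) = qI p + qI q"
  "qJ (p + q) = qJ p + qJ q" "qK (p + q) = qK p + qK q"
  "qRe (r *\<^sub>R q) = r * qRe q" "qI (r *\<^sub>R q) = r * qI q"
  "qJ (r *\<^sub>R q) = r * qJ q" "qK (r *\<^sub>R q) = r * qK q"
  by (simp_all add: quat_arith_defs)

lemma quat_of_real: "of_real r = Quat r 0 0 0"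
  by (simp add: of_real_def quat_eq_iff)

lemma quat_of_real_sel [simp]:
  "qRe (of_real r) = r" "qI (of_real r) = 0" "qJ (of_real r) = 0" "qK (of_real r) = 0"
  by (simp_all add: quat_of_real)

lemma quat_sel_sum:
  "qRe (sum f A) = (\<Sum>x\<in>A. qRe (f x))" "qI (sum f A) = (\<Sum>x\<in>A. qI (f x))"
  "qJ (sum f A) = (\<Sum>x\<in>A. qJ (f x))" "qK (sum f A) = (\<Sum>x\<in>A. qK (f x))"
  by (induction A rule: infinite_finite_induct; simp)+

text \<open>As for \<^typ>\<open>complex\<close> in \<^theory>\<open>HOL-Library.Complex_Order\<close>: \<open>0 \<le> q\<close> says that \<open>q\<close> is
  real and nonnegative.\<close>

instantiation quat :: order
begin

definition "p \<le> q \<longleftrightarrow> qRe p \<le> qRe q \<and> qI p = qI q \<and> qJ p = qJ q \<and> qK p = qK q"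
definition "(p :: quat) < q \<longleftrightarrow> p \<le> q \<and> \<not> q \<le> p"

instance
  by standard (auto simp: less_eq_quat_def less_quat_def quat_eq_iff)

end

definition qcnj :: "quat \<Rightarrow> quat" where
  "qcnj q = Quat (qRe q) (- qI q) (- qJ q) (- qK q)"

lemma qcnj_sel [simp]:
  "qRe (qcnj q) = qRe q" "qI (qcnj q) = - qI q" "qJ (qcnj q) = - qJ q" "qK (qcnj q) = - qK q"
  by (simp_all add: qcnj_def)

lemma qcnj_qcnj [simp]: "qcnj (qcnj q) = q"
  by (simp add: quat_eq_iff)

lemma qcnj_mult: "qcnj (p * q) = qcnj q * qcnj p"
  by (simp add: qcnj_def times_quat_def algebra_simps)

lemma qcnj_add: "qcnj (p + q) = qcnj p + qcnj q"
  by (simp add: quat_eq_iff)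

lemma qcnj_zero [simp]: "qcnj 0 = 0"
  by (simp add: quat_eq_iff)

lemma qcnj_sum: "qcnj (sum f A) = (\<Sum>x\<in>A. qcnj (f x))"
  by (induction A rule: infinite_finite_induct) (simp_all add: qcnj_add)


section \<open>Quaternionic and real matrices\<close>

definition mtrace :: "'a :: comm_monoid_add mat \<Rightarrow> 'a" where
  "mtrace A = (\<Sum>i<dim_row A. A $$ (i, i))"

definition qadjoint :: "quat mat \<Rightarrow> quat mat" where
  "qadjoint A = mat (dim_col A) (dim_row A) (\<lambda>(i, j). qcnj (A $$ (j, i)))"

text \<open>The quaternionic Hermitian \<open>N \<times> N\<close> matrices.\<close>

definition hermitian_mats :: "nat \<Rightarrow> quat mat set" where
  "hermitian_mats N = {A \<in> carrier_mat N N. qadjoint A = A}"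

text \<open>The form \<open>v\<^sup>* A v\<close>.\<close>

definition qform :: "quat mat \<Rightarrow> quat vec \<Rightarrow> quat" where
  "qform A v = map_vec qcnj v \<bullet> (A *\<^sub>v v)"

definition qpsd :: "nat \<Rightarrow> quat mat \<Rightarrow> bool" where
  "qpsd N A \<longleftrightarrow> A \<in> hermitian_mats N \<and> (\<forall>v \<in> carrier_vec N. 0 \<le> qform A v)"

definition qinner :: "quat mat \<Rightarrow> quat mat \<Rightarrow> real" where
  "qinner A Z = qRe (mtrace (qadjoint A * Z))"

definition symmetric_mats :: "nat \<Rightarrow> real mat set" where
  "symmetric_mats N = {S \<in> carrier_mat N N. transpose_mat S = S}"

definition rform :: "real mat \<Rightarrow> real vec \<Rightarrow> real" where
  "rform S v = v \<bullet> (S *\<^sub>v v)"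

definition rpsd :: "nat \<Rightarrow> real mat \<Rightarrow> bool" where
  "rpsd N S \<longleftrightarrow> S \<in> symmetric_mats N \<and> (\<forall>v \<in> carrier_vec N. 0 \<le> rform S v)"

definition rinner :: "real mat \<Rightarrow> real mat \<Rightarrow> real" where
  "rinner S Y = mtrace (transpose_mat S * Y)"


section \<open>First-order moment relaxations\<close>

text \<open>The first-order moment relaxation, built with \<open>[q]\<^sub>1 = (1, q\<^sub>1, \<dots>, q\<^sub>n)\<close>, of the quaternionic
  QCQP of minimizing \<open>[q]\<^sub>1\<^sup>* F [q]\<^sub>1\<close> subject to \<open>[q]\<^sub>1\<^sup>* (G i) [q]\<^sub>1 \<ge> 0\<close> for \<open>1 \<le> i \<le> m\<close> and
  \<open>[q]\<^sub>1\<^sup>* (H j) [q]\<^sub>1 = 0\<close> for \<open>1 \<le> j \<le> l\<close>. In \<^typ>\<open>ereal\<close>, the infimum of the empty set is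
  \<open>\<infinity>\<close>.\<close>

definition quat_moment_feasible ::
  "nat \<Rightarrow> nat \<Rightarrow> nat \<Rightarrow> (nat \<Rightarrow> quat mat) \<Rightarrow> (nat \<Rightarrow> quat mat) \<Rightarrow> quat mat set" where
  "quat_moment_feasible n m l G H = {Z \<in> hermitian_mats (n + 1).
     (\<forall>i\<in>{1..m}. qinner (G i) Z \<ge> 0) \<and> (\<forall>j\<in>{1..l}. qinner (H j) Z = 0) \<and>
     Z $$ (0, 0) = 1 \<and> qpsd (n + 1) Z}"

definition quat_moment_value ::
  "nat \<Rightarrow> nat \<Rightarrow> nat \<Rightarrow> quat mat \<Rightarrow> (nat \<Rightarrow> quat mat) \<Rightarrow> (nat \<Rightarrow> quat mat) \<Rightarrow> ereal" where
  "quat_moment_value n m l F G H =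
     (INF Z \<in> quat_moment_feasible n m l G H. ereal (qinner F Z))"

text \<open>The first-order moment (Shor) relaxation of the real QCQP in \<open>N\<close> variables of minimizing
  \<open>y\<^sup>T F y\<close> subject to \<open>y\<^sup>T (G i) y \<ge> 0\<close> and \<open>y\<^sup>T (H j) y = 0\<close>, where \<open>y = (1, x\<^sub>1, \<dots>, x\<^sub>N)\<close>.\<close>

definition real_moment_feasible ::
  "nat \<Rightarrow> nat \<Rightarrow> nat \<Rightarrow> (nat \<Rightarrow> real mat) \<Rightarrow> (nat \<Rightarrow> real mat) \<Rightarrow> real mat set" where
  "real_moment_feasible N m l G H = {Y \<in> symmetric_mats (N + 1).
     (\<forall>i\<in>{1..m}. rinner (G i) Y \<ge> 0) \<and> (\<forall>j\<in>{1..l}. rinner (H j) Y = 0) \<and>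
     Y $$ (0, 0) = 1 \<and> rpsd (N + 1) Y}"

definition real_moment_value ::
  "nat \<Rightarrow> nat \<Rightarrow> nat \<Rightarrow> real mat \<Rightarrow> (nat \<Rightarrow> real mat) \<Rightarrow> (nat \<Rightarrow> real mat) \<Rightarrow> ereal" where
  "real_moment_value N m l F G H =
     (INF Y \<in> real_moment_feasible N m l G H. ereal (rinner F Y))"


section \<open>From the quaternionic to the real problem\<close>

text \<open>For \<open>v = (t, x\<^sub>1, x\<^sub>2, x\<^sub>3, x\<^sub>4)\<close> with \<open>t\<close> real and each \<open>x\<^sub>s\<close> a real \<open>n\<close>-vector, \<open>\<tau>\<close> gives
  \<open>(t, x\<^sub>1 + x\<^sub>2 i + x\<^sub>3 j + x\<^sub>4 k)\<close>; entry \<open>a \<in> {1..n}\<close> of \<open>x\<^sub>s\<close> is entry \<open>(s - 1) n + a\<close> of \<open>v\<close>.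
  The vectors \<open>[q]\<^sub>1\<close> are exactly the values of \<open>\<tau>\<close> at the \<open>v\<close> with \<open>t = 1\<close>.\<close>

definition tau :: "nat \<Rightarrow> real vec \<Rightarrow> quat vec" where
  "tau n v = vec (n + 1) (\<lambda>a. if a = 0 then of_real (v $ 0)
     else Quat (v $ a) (v $ (n + a)) (v $ (2 * n + a)) (v $ (3 * n + a)))"

text \<open>Well defined for Hermitian \<open>A\<close> only, see \<open>Gamma_ex1\<close> below.\<close>

definition Gamma :: "nat \<Rightarrow> quat mat \<Rightarrow> real mat" where
  "Gamma n A = (THE S. S \<in> symmetric_mats (4 * n + 1) \<and>
     (\<forall>v \<in> carrier_vec (4 * n + 1). of_real (rform S v) = qform A (tau n v)))"

lemma qform_sum:
  assumes "A \<in> carrier_mat N N" "v \<in> carrier_vec N"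
  shows "qform A v = (\<Sum>i<N. \<Sum>j<N. qcnj (v $ i) * A $$ (i, j) * v $ j)"
  using assms
  by (auto simp: qform_def scalar_prod_def sum_distrib_left mult.assoc lessThan_atLeast0
      intro!: sum.cong)

lemma rform_sum:
  assumes "S \<in> carrier_mat N N" "v \<in> carrier_vec N"
  shows "rform S v = (\<Sum>i<N. \<Sum>j<N. v $ i * S $$ (i, j) * v $ j)"
  using assms
  by (auto simp: rform_def scalar_prod_def sum_distrib_left mult.assoc lessThan_atLeast0
      intro!: sum.cong)

lemma hermitian_entry:
  assumes "A \<in> hermitian_mats N" "i < N" "j < N"
  shows "qcnj (A $$ (i, j)) = A $$ (j, i)"
proof -
  have c: "A \<in> carrier_mat N N" and "qadjoint A = A"
    using assms by (auto simp: hermitian_mats_def)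
  hence "A $$ (j, i) = qadjoint A $$ (j, i)" by simp
  also have "\<dots> = qcnj (A $$ (i, j))" using c assms by (simp add: qadjoint_def)
  finally show ?thesis by simp
qed

lemma symmetric_entry:
  assumes "S \<in> symmetric_mats N" "i < N" "j < N"
  shows "S $$ (i, j) = S $$ (j, i)"
proof -
  have c: "S \<in> carrier_mat N N" and "transpose_mat S = S"
    using assms by (auto simp: symmetric_mats_def)
  hence "S $$ (i, j) = transpose_mat S $$ (i, j)" by simp
  also have "\<dots> = S $$ (j, i)" using c assms by simp
  finally show ?thesis .
qed

lemma qform_hermitian_real:
  assumes A: "A \<in> hermitian_mats N" and v: "v \<in> carrier_vec N"
  shows "of_real (qRe (qform A v)) = qform A v"
proof -
  have c: "A \<in> carrier_mat N N" using A by (simp add: hermitian_mats_def)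
  have "qcnj (qform A v) = (\<Sum>i<N. \<Sum>j<N. qcnj (v $ j) * A $$ (j, i) * v $ i)"
    by (auto simp: qform_sum[OF c v] qcnj_sum qcnj_mult hermitian_entry[OF A] mult.assoc
        intro!: sum.cong)
  also have "\<dots> = qform A v"
    by (subst sum.swap) (simp add: qform_sum[OF c v])
  finally show ?thesis by (auto simp: quat_eq_iff)
qed

lemma symmetric_form_unique:
  assumes S: "S \<in> symmetric_mats N" and T: "T \<in> symmetric_mats N"
    and eq: "\<And>v. v \<in> carrier_vec N \<Longrightarrow> rform S v = rform T v"
  shows "S = T"
proof -
  have c: "S \<in> carrier_mat N N" "T \<in> carrier_mat N N"
    using S T by (auto simp: symmetric_mats_def)
  have *: "rform M (vec N (\<lambda>k. of_bool (k = a) + c * of_bool (k = b))) =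
      M $$ (a, a) + c * M $$ (a, b) + c * M $$ (b, a) + c * c * M $$ (b, b)"
    if M: "M \<in> carrier_mat N N" and ab: "a < N" "b < N" for M a b and c :: real
  proof -
    have "rform M (vec N (\<lambda>k. of_bool (k = a) + c * of_bool (k = b))) =
      (\<Sum>i<N. \<Sum>j<N. (of_bool (i = a) + c * of_bool (i = b)) * M $$ (i, j) *
         (of_bool (j = a) + c * of_bool (j = b)))"
      by (subst rform_sum[OF M]) (auto intro!: sum.cong)
    also have "\<dots> = (\<Sum>i<N. (of_bool (i = a) + c * of_bool (i = b)) * (M $$ (i, a) + c * M $$ (i, b)))"
      using ab
      by (intro sum.cong refl)
        (simp add: distrib_left sum.distrib mult.assoc mult.left_commute[of _ c]
          flip: sum_distrib_left)
    also have "\<dots> = M $$ (a, a) + c * M $$ (a, b) + c * M $$ (b, a) + c * c * M $$ (b, b)"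
      using ab
      by (simp add: distrib_right distrib_left sum.distrib mult.assoc flip: sum_distrib_left)
    finally show ?thesis .
  qed
  have "S $$ (a, b) = T $$ (a, b)" if ab: "a < N" "b < N" for a b
  proof -
    have p: "M $$ (a, b) = (rform M (vec N (\<lambda>k. of_bool (k = a) + 1 * of_bool (k = b)))
       - rform M (vec N (\<lambda>k. of_bool (k = a) + (- 1) * of_bool (k = b)))) / 4"
      if M: "M \<in> symmetric_mats N" for M
    proof -
      have "M \<in> carrier_mat N N" using M by (simp add: symmetric_mats_def)
      then show ?thesis
        using symmetric_entry[OF M ab] unfolding *[OF \<open>M \<in> carrier_mat N N\<close> ab] by simp
    qed
    show ?thesis
      unfolding p[OF S] p[OF T] by (subst (1 2) eq) simp_all
  qed
  with c show ?thesis by (intro eq_matI) auto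
qed

lemma Gamma_ex1:
  assumes A: "A \<in> hermitian_mats (n + 1)"
  shows "\<exists>!S. S \<in> symmetric_mats (4 * n + 1) \<and>
     (\<forall>v \<in> carrier_vec (4 * n + 1). of_real (rform S v) = qform A (tau n v))"
proof -
  let ?N = "4 * n + 1"
  have c: "A \<in> carrier_mat (n + 1) (n + 1)" using A by (simp add: hermitian_mats_def)
  define e where "e k a = tau n (vec ?N (\<lambda>b. of_bool (b = k))) $ a" for k a
  define S where "S = mat ?N ?N (\<lambda>(k, l). \<Sum>i<n+1. \<Sum>j<n+1.
     qRe (qcnj (e k i) * A $$ (i, j) * e l j))"
  have tau_c: "tau n v \<in> carrier_vec (n + 1)" for v by (simp add: tau_def)
  have tau_e: "tau n v $ a = (\<Sum>k<?N. (v $ k) *\<^sub>R e k a)" if "a < n + 1" for v a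
  proof -
    have d: "b < K \<Longrightarrow> (\<Sum>k<K. v $ k * of_bool (b = k)) = v $ b"
      "b < K \<Longrightarrow> (\<Sum>k<K. v $ k * of_bool (k = b)) = v $ b" for b K :: nat
      by simp_all
    show ?thesis
      using \<open>a < n + 1\<close>
      by (auto simp: e_def tau_def quat_eq_iff quat_sel_sum d
          simp del: sum_mult_of_bool_eq sum.lessThan_Suc)
  qed
  have "S \<in> symmetric_mats ?N"
  proof -
    have "(\<Sum>i<n+1. \<Sum>j<n+1. qRe (qcnj (e l i) * A $$ (i, j) * e k j)) =
       (\<Sum>i<n+1. \<Sum>j<n+1. qRe (qcnj (e k i) * A $$ (i, j) * e l j))" for k l
    proof -
      have "(\<Sum>i<n+1. \<Sum>j<n+1. qRe (qcnj (e l i) * A $$ (i, j) * e k j)) =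
        (\<Sum>i<n+1. \<Sum>j<n+1. qRe (qcnj (qcnj (e l i) * A $$ (i, j) * e k j)))" by simp
      also have "\<dots> = (\<Sum>i<n+1. \<Sum>j<n+1. qRe (qcnj (e k j) * A $$ (j, i) * e l i))"
        by (intro sum.cong refl)
          (simp add: qcnj_mult hermitian_entry[OF A] mult.assoc del: qcnj_sel)
      also have "\<dots> = (\<Sum>i<n+1. \<Sum>j<n+1. qRe (qcnj (e k i) * A $$ (i, j) * e l j))"
        by (rule sum.swap)
      finally show ?thesis .
    qed
    then show ?thesis
      unfolding symmetric_mats_def S_def by (auto intro!: eq_matI)
  qed
  moreover have "of_real (rform S v) = qform A (tau n v)" if v: "v \<in> carrier_vec ?N" for v
  proof -
    have Sc: "S \<in> carrier_mat ?N ?N" by (simp add: S_def)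
    have r: "qRe (qcnj (a *\<^sub>R p) * x * (b *\<^sub>R q)) = a * b * qRe (qcnj p * x * q)" for a b p x q
      by (simp add: times_quat_def algebra_simps)
    have "qRe (qform A (tau n v)) = (\<Sum>i<n+1. \<Sum>j<n+1.
        qRe (qcnj (tau n v $ i) * A $$ (i, j) * tau n v $ j))"
      by (simp only: qform_sum[OF c tau_c] quat_sel_sum)
    also have "\<dots> = (\<Sum>i<n+1. \<Sum>j<n+1. \<Sum>k<?N. \<Sum>l<?N.
        v $ k * v $ l * qRe (qcnj (e k i) * A $$ (i, j) * e l j))"
    proof (intro sum.cong refl)
      fix i j assume ij: "i \<in> {..<n+1}" "j \<in> {..<n+1}"
      have "qcnj (tau n v $ i) * A $$ (i, j) * tau n v $ j =
        (\<Sum>k<?N. \<Sum>l<?N. qcnj (v $ k *\<^sub>R e k i) * A $$ (i, j) * (v $ l *\<^sub>R e l j))"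
        using ij by (simp only: tau_e lessThan_iff qcnj_sum sum_distrib_left sum_distrib_right)
         (rule sum.swap)
      then show "qRe (qcnj (tau n v $ i) * A $$ (i, j) * tau n v $ j) = (\<Sum>k<?N. \<Sum>l<?N.
        v $ k * v $ l * qRe (qcnj (e k i) * A $$ (i, j) * e l j))"
        by (simp only: quat_sel_sum r)
    qed
    also have "\<dots> = (\<Sum>k<?N. \<Sum>l<?N. \<Sum>i<n+1. \<Sum>j<n+1.
        v $ k * v $ l * qRe (qcnj (e k i) * A $$ (i, j) * e l j))"
    proof -
      have sw: "(\<Sum>i<M. \<Sum>j<M. \<Sum>k<K. \<Sum>l<K. f i j k l) =
        (\<Sum>k<K. \<Sum>l<K. \<Sum>i<M. \<Sum>j<M. f i j k l)"
        for M K and f :: "nat \<Rightarrow> nat \<Rightarrow> nat \<Rightarrow> nat \<Rightarrow> real"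
      proof -
        have "(\<Sum>i<M. \<Sum>j<M. \<Sum>k<K. \<Sum>l<K. f i j k l) = (\<Sum>i<M. \<Sum>k<K. \<Sum>j<M. \<Sum>l<K. f i j k l)"
          by (intro sum.cong refl sum.swap)
        also have "\<dots> = (\<Sum>k<K. \<Sum>i<M. \<Sum>j<M. \<Sum>l<K. f i j k l)" by (rule sum.swap)
        also have "\<dots> = (\<Sum>k<K. \<Sum>i<M. \<Sum>l<K. \<Sum>j<M. f i j k l)"
          by (intro sum.cong refl sum.swap)
        also have "\<dots> = (\<Sum>k<K. \<Sum>l<K. \<Sum>i<M. \<Sum>j<M. f i j k l)"
          by (intro sum.cong refl sum.swap)
        finally show ?thesis .
      qed
      show ?thesis by (rule sw)
    qed
    also have "\<dots> = rform S v"
      unfolding rform_sum[OF Sc v] by (intro sum.cong refl)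
        (simp add: S_def sum_distrib_left sum_distrib_right mult.assoc mult.left_commute mult.commute del: sum.lessThan_Suc)
    finally have "rform S v = qRe (qform A (tau n v))" ..
    then show ?thesis using qform_hermitian_real[OF A tau_c] by simp
  qed
  ultimately show ?thesis
    by (intro ex1I[of _ S]) (auto intro!: symmetric_form_unique simp flip: of_real_eq_iff[where 'a = quat])
qed

lemma Gamma_symmetric: "A \<in> hermitian_mats (n + 1) \<Longrightarrow> Gamma n A \<in> symmetric_mats (4 * n + 1)"
  and Gamma_form: "A \<in> hermitian_mats (n + 1) \<Longrightarrow> v \<in> carrier_vec (4 * n + 1) \<Longrightarrow>
    of_real (rform (Gamma n A) v) = qform A (tau n v)"
  using theI'[OF Gamma_ex1, of A n] by (auto simp: Gamma_def)

end

theory Submission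
  imports Defs
begin

text \<open>Let \<open>T\<close> be the real-linear map \<open>tau n\<close>, with columns \<open>e\<^sub>k\<close>. The map
  \<open>Y \<mapsto> T Y T\<^sup>*\<close> is adjoint to \<open>Gamma n\<close>, preserves semidefiniteness and the entry at
  \<open>(0, 0)\<close>, so it carries feasible points of the real relaxation to feasible points of the
  quaternionic one with the same objective. It remains to find a semidefinite preimage of a
  semidefinite \<open>Z\<close> with \<open>Z\<^sub>0\<^sub>0 = 1\<close>. Let \<open>z\<close> be column 0 of \<open>Z\<close>. As \<open>z\<^sub>0\<close> is real,
  \<open>z = T v\<close> for a real vector \<open>v\<close>, and the Schur complement \<open>S = Z - z z\<^sup>*\<close> is
  semidefinite with vanishing row and column 0. On such matrices \<open>T (Gamma n S) T\<^sup>* = 4 S\<close>,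
  since every quaternionic direction is counted once for each of the four units. Hence
  \<open>v v\<^sup>T + Gamma n S / 4\<close> is the desired preimage.\<close>

section \<open>Sum rearrangement and quaternion arithmetic\<close>

lemma sum_swap4:
  fixes f :: "'a \<Rightarrow> 'b \<Rightarrow> 'c \<Rightarrow> 'd \<Rightarrow> 'e::comm_monoid_add"
  shows "(\<Sum>i\<in>I. \<Sum>j\<in>J. \<Sum>k\<in>K. \<Sum>l\<in>L. f i j k l) = (\<Sum>k\<in>K. \<Sum>l\<in>L. \<Sum>i\<in>I. \<Sum>j\<in>J. f i j k l)"
proof -
  have "(\<Sum>i\<in>I. \<Sum>j\<in>J. \<Sum>k\<in>K. \<Sum>l\<in>L. f i j k l) = (\<Sum>i\<in>I. \<Sum>k\<in>K. \<Sum>j\<in>J. \<Sum>l\<in>L. f i j k l)"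
    by (intro sum.cong refl sum.swap)
  also have "\<dots> = (\<Sum>k\<in>K. \<Sum>i\<in>I. \<Sum>j\<in>J. \<Sum>l\<in>L. f i j k l)" by (rule sum.swap)
  also have "\<dots> = (\<Sum>k\<in>K. \<Sum>i\<in>I. \<Sum>l\<in>L. \<Sum>j\<in>J. f i j k l)"
    by (intro sum.cong refl sum.swap)
  also have "\<dots> = (\<Sum>k\<in>K. \<Sum>l\<in>L. \<Sum>i\<in>I. \<Sum>j\<in>J. f i j k l)"
    by (intro sum.cong refl sum.swap)
  finally show ?thesis .
qed

lemma quat_sel_minus [simp]:
  "qRe (p - q) = qRe p - qRe q" "qI (p - q) = qI p - qI q"
  "qJ (p - q) = qJ p - qJ q" "qK (p - q) = qK p - qK q"
  by (simp_all add: quat_arith_defs)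

lemma qcnj_diff: "qcnj (p - q) = qcnj p - qcnj q"
  by (simp add: quat_eq_iff)

lemma qcnj_scaleR: "qcnj (r *\<^sub>R q) = r *\<^sub>R qcnj q"
  by (simp add: quat_eq_iff)

text \<open>Commutators of quaternions are purely imaginary. This allows the cyclic moves under
  \<open>qRe\<close> that stand in for commutativity in trace computations.\<close>

lemma qRe_mult_commute: "qRe (p * q) = qRe (q * p)"
  by (simp add: times_quat_def)

section \<open>Real linearity and columns of \<open>tau\<close>\<close>

lemma tau_carrier: "tau n v \<in> carrier_vec (n + 1)"
  by (simp add: tau_def)

lemma tau_add:
  assumes "u \<in> carrier_vec (4 * n + 1)" "v \<in> carrier_vec (4 * n + 1)"
  shows "tau n (u + v) = tau n u + tau n v"
  using assms by (intro eq_vecI) (auto simp: tau_def quat_eq_iff)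

lemma tau_diff:
  assumes "u \<in> carrier_vec (4 * n + 1)" "v \<in> carrier_vec (4 * n + 1)"
  shows "tau n (u - v) = tau n u - tau n v"
  using assms by (intro eq_vecI) (auto simp: tau_def quat_eq_iff)

text \<open>\<open>frame n k\<close> is the vector \<open>e\<^sub>k\<close>.\<close>

definition frame :: "nat \<Rightarrow> nat \<Rightarrow> nat \<Rightarrow> quat" where
  "frame n k a = tau n (unit_vec (4 * n + 1) k) $ a"

lemma frame_0: "frame n k 0 = of_real (of_bool (k = 0))"
  by (simp add: frame_def tau_def unit_vec_def)

text \<open>Entry \<open>a > 0\<close> is fed by four columns, carrying the four units, whereas
  entry 0 is fed by column 0 alone.\<close>

lemma frame_eq:
  assumes "0 < a" "a \<le> n" "k \<le> 4 * n"
  shows "frame n k a =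
    Quat (of_bool (k = a)) (of_bool (k = n + a)) (of_bool (k = 2 * n + a)) (of_bool (k = 3 * n + a))"
  using assms by (auto simp: frame_def tau_def)

lemma tau_frame:
  assumes "a < n + 1"
  shows "tau n v $ a = (\<Sum>k<4*n+1. (v $ k) *\<^sub>R frame n k a)"
proof -
  have d: "(\<Sum>k<K. v $ k * of_bool (k = b)) = v $ b" if "b < K" for b K :: nat
    using that by simp
  show ?thesis
  proof (cases "a = 0")
    case True
    then show ?thesis
      by (simp add: frame_0 tau_def quat_eq_iff quat_sel_sum d
          del: sum_mult_of_bool_eq sum.lessThan_Suc)
  next
    case False
    have "(\<Sum>k<4*n+1. (v $ k) *\<^sub>R frame n k a) = (\<Sum>k<4*n+1. (v $ k) *\<^sub>R
      Quat (of_bool (k = a)) (of_bool (k = n + a)) (of_bool (k = 2 * n + a)) (of_bool (k = 3 * n + a)))"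
      using False assms by (intro sum.cong refl arg_cong2[where f = scaleR] frame_eq) auto
    also have "\<dots> = tau n v $ a"
      using False assms by (simp add: tau_def quat_eq_iff quat_sel_sum d
          del: sum_mult_of_bool_eq sum.lessThan_Suc)
    finally show ?thesis ..
  qed
qed

section \<open>Lifting real symmetric matrices to Hermitian ones\<close>

text \<open>The matrix \<open>T Y T\<^sup>*\<close>.\<close>

definition lift :: "nat \<Rightarrow> real mat \<Rightarrow> quat mat" where
  "lift n Y = mat (n + 1) (n + 1) (\<lambda>(i, j). \<Sum>k<4*n+1. \<Sum>l<4*n+1.
     Y $$ (k, l) *\<^sub>R (frame n k i * qcnj (frame n l j)))"

lemma lift_carrier: "lift n Y \<in> carrier_mat (n + 1) (n + 1)"
  by (simp add: lift_def)

lemma lift_hermitian: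
  assumes Y: "Y \<in> symmetric_mats (4 * n + 1)"
  shows "lift n Y \<in> hermitian_mats (n + 1)"
proof -
  have "qcnj (lift n Y $$ (j, i)) = lift n Y $$ (i, j)" if ij: "i < n + 1" "j < n + 1" for i j
  proof -
    have "qcnj (lift n Y $$ (j, i)) =
        (\<Sum>k<4*n+1. \<Sum>l<4*n+1. Y $$ (l, k) *\<^sub>R (frame n l i * qcnj (frame n k j)))"
      using ij symmetric_entry[OF Y]
      by (auto simp: lift_def qcnj_sum qcnj_scaleR qcnj_mult simp del: sum.lessThan_Suc intro!: sum.cong)
    also have "\<dots> = lift n Y $$ (i, j)"
      using ij by (subst sum.swap) (simp add: lift_def del: sum.lessThan_Suc)
    finally show ?thesis .
  qed
  then show ?thesis
    by (auto simp: hermitian_mats_def qadjoint_def lift_def intro!: eq_matI)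
qed

lemma lift_00: "lift n Y $$ (0, 0) = of_real (Y $$ (0, 0))"
proof -
  have "lift n Y $$ (0, 0) =
      (\<Sum>k<4*n+1. \<Sum>l<4*n+1. Y $$ (k, l) *\<^sub>R (frame n k 0 * qcnj (frame n l 0)))"
    by (simp add: lift_def del: sum.lessThan_Suc)
  also have "\<dots> = (\<Sum>k<4*n+1. \<Sum>l<4*n+1.
      (if l = 0 then if k = 0 then of_real (Y $$ (k, l)) else 0 else 0))"
    by (intro sum.cong refl) (simp add: frame_0 quat_eq_iff times_quat_def)
  also have "\<dots> = of_real (Y $$ (0, 0))" by (subst sum.delta; simp)+
  finally show ?thesis .
qed

text \<open>\<open>u\<close> is \<open>T\<^sup>* w\<close>, with quaternion entries. The real
  entries of \<open>Y\<close> commute with all factors, so the form regroups as that of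
  \<open>Y\<close> at \<open>u\<close>.\<close>

lemma qform_lift:
  assumes w: "w \<in> carrier_vec (n + 1)"
  defines "u \<equiv> \<lambda>k. \<Sum>i<n+1. qcnj (frame n k i) * w $ i"
  shows "qform (lift n Y) w = (\<Sum>k<4*n+1. \<Sum>l<4*n+1. Y $$ (k, l) *\<^sub>R (qcnj (u k) * u l))"
proof -
  have "qform (lift n Y) w = (\<Sum>i<n+1. \<Sum>j<n+1. \<Sum>k<4*n+1. \<Sum>l<4*n+1. Y $$ (k, l) *\<^sub>R
      (qcnj (w $ i) * frame n k i * (qcnj (frame n l j) * w $ j)))"
    unfolding qform_sum[OF lift_carrier w]
    by (intro sum.cong refl)
      (simp add: lift_def sum_distrib_left sum_distrib_right mult.assoc del: sum.lessThan_Suc)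
  also have "\<dots> = (\<Sum>k<4*n+1. \<Sum>l<4*n+1. \<Sum>i<n+1. \<Sum>j<n+1. Y $$ (k, l) *\<^sub>R
      (qcnj (w $ i) * frame n k i * (qcnj (frame n l j) * w $ j)))"
    by (rule sum_swap4)
  also have "\<dots> = (\<Sum>k<4*n+1. \<Sum>l<4*n+1. Y $$ (k, l) *\<^sub>R (qcnj (u k) * u l))"
    by (simp only: u_def qcnj_sum qcnj_mult qcnj_qcnj sum_product scaleR_sum_right)
  finally show ?thesis .
qed

text \<open>The real part of \<open>qcnj p * q\<close> is the Euclidean inner product of the
  component 4-vectors. Hence the form of the lift at \<open>w\<close> is the sum of the values of
  the form of \<open>Y\<close> at the four real component vectors of
  \<open>T\<^sup>* w\<close>.\<close>

lemma lift_psd: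
  assumes Y: "rpsd (4 * n + 1) Y"
  shows "qpsd (n + 1) (lift n Y)"
proof -
  let ?N = "4 * n + 1"
  have sym: "Y \<in> symmetric_mats ?N" using Y by (simp add: rpsd_def)
  have c: "Y \<in> carrier_mat ?N ?N" using sym by (simp add: symmetric_mats_def)
  have nn: "0 \<le> (\<Sum>k<?N. \<Sum>l<?N. f k * Y $$ (k, l) * f l)" for f
  proof -
    have "0 \<le> rform Y (vec ?N f)" using Y by (simp add: rpsd_def)
    also have "\<dots> = (\<Sum>k<?N. \<Sum>l<?N. f k * Y $$ (k, l) * f l)"
      by (subst rform_sum[OF c]) (auto intro!: sum.cong)
    finally show ?thesis .
  qed
  have "0 \<le> qform (lift n Y) w" if w: "w \<in> carrier_vec (n + 1)" for w
  proof -
    define u where "u k = (\<Sum>i<n+1. qcnj (frame n k i) * w $ i)" for k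
    have "qRe (qform (lift n Y) w) = (\<Sum>k<?N. \<Sum>l<?N. qRe (Y $$ (k, l) *\<^sub>R (qcnj (u k) * u l)))"
      unfolding u_def by (simp only: qform_lift[OF w] quat_sel_sum)
    also have "\<dots> = (\<Sum>k<?N. \<Sum>l<?N. qRe (u k) * Y $$ (k, l) * qRe (u l))
      + (\<Sum>k<?N. \<Sum>l<?N. qI (u k) * Y $$ (k, l) * qI (u l))
      + (\<Sum>k<?N. \<Sum>l<?N. qJ (u k) * Y $$ (k, l) * qJ (u l))
      + (\<Sum>k<?N. \<Sum>l<?N. qK (u k) * Y $$ (k, l) * qK (u l))"
      unfolding sum.distrib[symmetric]
      by (intro sum.cong refl) (simp add: times_quat_def algebra_simps)
    also have "\<dots> \<ge> 0" by (intro add_nonneg_nonneg nn)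
    finally have "0 \<le> qRe (qform (lift n Y) w)" .
    \<comment> \<open>The order on \<open>quat\<close> also asks for equal imaginary parts;
      Hermitian symmetry makes them vanish.\<close>
    moreover have "qform (lift n Y) w = of_real (qRe (qform (lift n Y) w))"
      using qform_hermitian_real[OF lift_hermitian[OF sym] w] ..
    ultimately show ?thesis by (metis less_eq_quat_def quat_of_real_sel quat_sel(1-4))
  qed
  then show ?thesis using lift_hermitian[OF sym] by (simp add: qpsd_def)
qed

section \<open>Adjointness of \<open>Gamma\<close> and \<open>lift\<close>\<close>

text \<open>Polarization of the identity that defines \<open>Gamma\<close>.\<close>

lemma Gamma_entry:
  assumes A: "A \<in> hermitian_mats (n + 1)" and kl: "k < 4 * n + 1" "l < 4 * n + 1"
  shows "Gamma n A $$ (k, l) =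
    (\<Sum>i<n+1. \<Sum>j<n+1. qRe (qcnj (frame n k i) * A $$ (i, j) * frame n l j))"
proof -
  let ?N = "4 * n + 1" and ?M = "n + 1"
  let ?S = "Gamma n A"
  let ?u = "unit_vec ?N k :: real vec" and ?v = "unit_vec ?N l :: real vec"
  have S: "?S \<in> symmetric_mats ?N" by (rule Gamma_symmetric[OF A])
  have Sc: "?S \<in> carrier_mat ?N ?N" using S by (simp add: symmetric_mats_def)
  have Ac: "A \<in> carrier_mat ?M ?M" using A by (simp add: hermitian_mats_def)
  have Sa: "?S $$ (a, b) = ?S $$ (b, a)" if "a < ?N" "b < ?N" for a b
    using symmetric_entry[OF S that] .
  have G: "rform ?S v = qRe (qform A (tau n v))" if "v \<in> carrier_vec ?N" for v
    using Gamma_form[OF A that] by (metis quat_of_real_sel(1))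
  have delta: "(\<Sum>i<?N. \<Sum>j<?N. ?u $ i * ?S $$ (i, j) * ?v $ j) = ?S $$ (k, l)"
  proof -
    have "(\<Sum>i<?N. \<Sum>j<?N. ?u $ i * ?S $$ (i, j) * ?v $ j) =
        (\<Sum>i<?N. \<Sum>j<?N. if j = l then if i = k then ?S $$ (i, j) else 0 else 0)"
      by (intro sum.cong refl) (auto simp: unit_vec_def)
    also have "\<dots> = ?S $$ (k, l)" using kl by (simp del: sum.lessThan_Suc)
    finally show ?thesis .
  qed
  have sw: "(\<Sum>i<?N. \<Sum>j<?N. ?v $ i * ?S $$ (i, j) * ?u $ j) =
     (\<Sum>i<?N. \<Sum>j<?N. ?u $ i * ?S $$ (i, j) * ?v $ j)"
    by (subst sum.swap) (auto simp: Sa intro!: sum.cong simp del: sum.lessThan_Suc)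
  \<comment> \<open>The pure terms cancel and the mixed ones double; symmetry then merges the two
    mixed sums into four copies of one entry.\<close>
  have "rform ?S (?u + ?v) - rform ?S (?u - ?v) =
      2 * (\<Sum>i<?N. \<Sum>j<?N. ?u $ i * ?S $$ (i, j) * ?v $ j)
    + 2 * (\<Sum>i<?N. \<Sum>j<?N. ?v $ i * ?S $$ (i, j) * ?u $ j)"
  proof -
    have "(x + y) * a * (z + w) - (x - y) * a * (z - w) = 2 * (x * a * w) + 2 * (y * a * z)"
      for x y a z w :: real
      by (simp add: algebra_simps)
    moreover have "rform ?S (?u + ?v) =
        (\<Sum>i<?N. \<Sum>j<?N. (?u $ i + ?v $ i) * ?S $$ (i, j) * (?u $ j + ?v $ j))"
      by (subst rform_sum[OF Sc]) (auto intro!: sum.cong simp: index_unit_vec(3) simp del: sum.lessThan_Suc index_unit_vec(1,2))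
    moreover have "rform ?S (?u - ?v) =
        (\<Sum>i<?N. \<Sum>j<?N. (?u $ i - ?v $ i) * ?S $$ (i, j) * (?u $ j - ?v $ j))"
      by (subst rform_sum[OF Sc]) (auto intro!: sum.cong simp: index_unit_vec(3) simp del: sum.lessThan_Suc index_unit_vec(1,2))
    ultimately show ?thesis
      by (simp only: sum_distrib_left flip: sum.distrib sum_subtractf)
  qed
  also have "\<dots> = 4 * ?S $$ (k, l)" unfolding sw delta by simp
  finally have r: "4 * ?S $$ (k, l) = rform ?S (?u + ?v) - rform ?S (?u - ?v)" ..
  define p q where "p = tau n ?u" and "q = tau n ?v"
  have pq: "p \<in> carrier_vec ?M" "q \<in> carrier_vec ?M"
    by (simp_all add: p_def q_def tau_def)
  \<comment> \<open>Conjugation keeps \<open>qRe\<close> and swaps the arguments, so the real part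
    of the sesquilinear form of \<open>A\<close> is a symmetric real bilinear form, to which the
    same polarization applies.\<close>
  have hr: "qRe (qcnj x * A $$ (i, j) * y) = qRe (qcnj y * A $$ (j, i) * x)"
    if "i < ?M" "j < ?M" for i j x y
  proof -
    have "qRe (qcnj x * A $$ (i, j) * y) = qRe (qcnj (qcnj x * A $$ (i, j) * y))" by simp
    also have "\<dots> = qRe (qcnj y * A $$ (j, i) * x)"
      using that by (simp add: qcnj_mult hermitian_entry[OF A] mult.assoc del: qcnj_sel)
    finally show ?thesis .
  qed
  let ?B = "\<lambda>x y. \<Sum>i<?M. \<Sum>j<?M. qRe (qcnj (x $ i) * A $$ (i, j) * y $ j)"
  have sw': "?B q p = ?B p q"
    by (subst sum.swap) (auto simp: hr simp del: sum.lessThan_Suc intro!: sum.cong)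
  have "qRe (qform A (p + q)) - qRe (qform A (p - q)) = 2 * ?B p q + 2 * ?B q p"
  proof -
    have "qRe (qcnj (x + y) * a * (z + w)) - qRe (qcnj (x - y) * a * (z - w)) =
        2 * qRe (qcnj x * a * w) + 2 * qRe (qcnj y * a * z)" for x y a z w
      by (simp add: qcnj_add qcnj_diff algebra_simps)
    moreover have "qRe (qform A (p + q)) =
        (\<Sum>i<?M. \<Sum>j<?M. qRe (qcnj (p $ i + q $ i) * A $$ (i, j) * (p $ j + q $ j)))"
      using pq by (subst qform_sum[OF Ac]) (auto simp: quat_sel_sum intro!: sum.cong simp del: sum.lessThan_Suc)
    moreover have "qRe (qform A (p - q)) =
        (\<Sum>i<?M. \<Sum>j<?M. qRe (qcnj (p $ i - q $ i) * A $$ (i, j) * (p $ j - q $ j)))"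
      using pq by (subst qform_sum[OF Ac]) (auto simp: quat_sel_sum intro!: sum.cong simp del: sum.lessThan_Suc)
    ultimately show ?thesis
      by (simp only: sum_distrib_left flip: sum.distrib sum_subtractf)
  qed
  also have "\<dots> = 4 * ?B p q" unfolding sw' by simp
  finally have "4 * ?S $$ (k, l) = 4 * ?B p q"
    unfolding r p_def q_def by (simp add: G tau_add tau_diff)
  then show ?thesis by (simp add: p_def q_def frame_def del: sum.lessThan_Suc)
qed

text \<open>Expanding \<open>lift\<close> and cycling the frame factors under \<open>qRe\<close>
  turns the quaternionic inner product into a sum over \<open>k\<close>, \<open>l\<close> of entries
  of \<open>Y\<close> times the expression in \<open>Gamma_entry\<close>.\<close>

lemma rinner_Gamma:
  assumes A: "A \<in> hermitian_mats (n + 1)" and Y: "Y \<in> symmetric_mats (4 * n + 1)"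
  shows "rinner (Gamma n A) Y = qinner A (lift n Y)"
proof -
  let ?N = "4 * n + 1" and ?M = "n + 1"
  have Sc: "Gamma n A \<in> carrier_mat ?N ?N"
    using Gamma_symmetric[OF A] by (simp add: symmetric_mats_def)
  have Yc: "Y \<in> carrier_mat ?N ?N" using Y by (simp add: symmetric_mats_def)
  have Ac: "A \<in> carrier_mat ?M ?M" using A by (simp add: hermitian_mats_def)
  have "qinner A (lift n Y) = (\<Sum>i<?M. \<Sum>j<?M. qRe (qcnj (A $$ (j, i)) * lift n Y $$ (j, i)))"
    using Ac lift_carrier[of n Y]
    by (auto simp: qinner_def mtrace_def qadjoint_def scalar_prod_def quat_sel_sum lessThan_atLeast0
        intro!: sum.cong)
  also have "\<dots> = (\<Sum>i<?M. \<Sum>j<?M. \<Sum>k<?N. \<Sum>l<?N.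
      Y $$ (k, l) * qRe (qcnj (frame n l i) * A $$ (i, j) * frame n k j))"
  proof (intro sum.cong refl)
    fix i j assume ij: "i \<in> {..<?M}" "j \<in> {..<?M}"
    show "qRe (qcnj (A $$ (j, i)) * lift n Y $$ (j, i)) = (\<Sum>k<?N. \<Sum>l<?N.
      Y $$ (k, l) * qRe (qcnj (frame n l i) * A $$ (i, j) * frame n k j))"
      using ij by (simp add: hermitian_entry[OF A] lift_def sum_distrib_left quat_sel_sum mult.assoc
          qRe_mult_commute[of "qcnj _"] del: sum.lessThan_Suc qcnj_sel)
  qed
  also have "\<dots> = (\<Sum>k<?N. \<Sum>l<?N. \<Sum>i<?M. \<Sum>j<?M.
      Y $$ (k, l) * qRe (qcnj (frame n l i) * A $$ (i, j) * frame n k j))"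
    by (rule sum_swap4)
  \<comment> \<open>The entries of \<open>Gamma n A\<close> and \<open>Y\<close> meet at transposed
    positions; symmetry of \<open>Y\<close> aligns them.\<close>
  also have "\<dots> = (\<Sum>k<?N. \<Sum>l<?N. Gamma n A $$ (l, k) * Y $$ (l, k))"
    by (intro sum.cong refl)
      (simp add: Gamma_entry[OF A] symmetric_entry[OF Y] sum_distrib_left sum_distrib_right
        mult.commute del: sum.lessThan_Suc)
  also have "\<dots> = rinner (Gamma n A) Y"
    using Sc Yc
    by (auto simp: rinner_def mtrace_def scalar_prod_def lessThan_atLeast0 intro!: sum.cong)
  finally show ?thesis ..
qed

section \<open>Composing \<open>lift\<close> with \<open>Gamma\<close>\<close>

text \<open>For \<open>0 < i\<close> the coefficients are the four real components of
  \<open>x\<close>, at the four positions belonging to entry \<open>i\<close>, and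
  \<open>tau\<close> reassembles them. At \<open>i = 0\<close> only the real part of
  \<open>x\<close> would survive.\<close>

lemma frame_expansion:
  assumes "0 < i" "i \<le> n" "a \<le> n"
  shows "(\<Sum>k<4*n+1. qRe (qcnj (frame n k i) * x) *\<^sub>R frame n k a) = (if a = i then x else 0)"
proof -
  have "(\<Sum>k<4*n+1. qRe (qcnj (frame n k i) * x) *\<^sub>R frame n k a) =
      tau n (vec (4 * n + 1) (\<lambda>k. qRe (qcnj (frame n k i) * x))) $ a"
    using assms by (simp add: tau_frame del: sum.lessThan_Suc)
  also have "\<dots> = (if a = i then x else 0)"
    using assms by (auto simp: tau_def frame_eq times_quat_def quat_eq_iff)
  finally show ?thesis .
qed

text \<open>Distinct rows of \<open>T\<close> have disjoint supports, and row \<open>i > 0\<close>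
  contains four units, each of norm 1. This is the source of the factor 4.\<close>

lemma frame_orthogonal:
  assumes "0 < i" "i \<le> n" "b \<le> n"
  shows "(\<Sum>l<4*n+1. frame n l i * qcnj (frame n l b)) = (if b = i then 4 *\<^sub>R 1 else 0)"
proof -
  have "frame n l i * qcnj (frame n l b) = (if b = i then of_real (of_bool (l = i)
      + of_bool (l = n + i) + of_bool (l = 2 * n + i) + of_bool (l = 3 * n + i)) else 0)"
    if "l < 4 * n + 1" for l
  proof (cases "b = 0")
    case True
    then show ?thesis using that assms by (auto simp: frame_0 frame_eq quat_eq_iff times_quat_def)
  next
    case False
    then show ?thesis using that assms by (auto simp: frame_eq quat_eq_iff times_quat_def)
  qed
  then have "(\<Sum>l<4*n+1. frame n l i * qcnj (frame n l b)) =
    (\<Sum>l<4*n+1. (if b = i then of_real (of_bool (l = i)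
      + of_bool (l = n + i) + of_bool (l = 2 * n + i) + of_bool (l = 3 * n + i)) else 0))"
    by (intro sum.cong) auto
  also have "\<dots> = (if b = i then of_real 4 else 0)"
  proof -
    have d: "(\<Sum>l<K. of_bool (l = c) :: real) = 1" if "c < K" for c K :: nat
      using that by simp
    show ?thesis
      using assms by (auto simp: sum.distrib d simp del: sum.lessThan_Suc sum_of_bool_eq simp flip: of_real_sum)
  qed
  finally show ?thesis by (simp only: of_real_def)
qed

text \<open>Entry 0 has one column instead of four, so the uniform factor 4 is available only where
  row and column 0 of \<open>A\<close> vanish.\<close>

lemma lift_Gamma:
  assumes A: "A \<in> hermitian_mats (n + 1)" and A0: "\<And>j. j \<le> n \<Longrightarrow> A $$ (0, j) = 0"
    and ab: "a \<le> n" "b \<le> n"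
  shows "lift n (Gamma n A) $$ (a, b) = 4 *\<^sub>R A $$ (a, b)"
proof -
  let ?N = "4 * n + 1" and ?M = "n + 1"
  have A0': "A $$ (j, 0) = 0" if "j \<le> n" for j
    using hermitian_entry[OF A, of 0 j] A0[OF that] that by simp
  have "lift n (Gamma n A) $$ (a, b) = (\<Sum>k<?N. \<Sum>l<?N. \<Sum>i<?M. \<Sum>j<?M.
      qRe (qcnj (frame n k i) * (A $$ (i, j) * frame n l j)) *\<^sub>R (frame n k a * qcnj (frame n l b)))"
    using ab by (simp add: lift_def Gamma_entry[OF A] scaleR_sum_left mult.assoc del: sum.lessThan_Suc)
  also have "\<dots> = (\<Sum>i<?M. \<Sum>j<?M. \<Sum>k<?N. \<Sum>l<?N.
      qRe (qcnj (frame n k i) * (A $$ (i, j) * frame n l j)) *\<^sub>R (frame n k a * qcnj (frame n l b)))"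
    by (rule sum_swap4)
  also have "\<dots> = (\<Sum>i<?M. \<Sum>j<?M. if b = j then if a = i then 4 *\<^sub>R A $$ (i, j) else 0 else 0)"
  proof (intro sum.cong refl)
    fix i j assume ij: "i \<in> {..<?M}" "j \<in> {..<?M}"
    show "(\<Sum>k<?N. \<Sum>l<?N.
      qRe (qcnj (frame n k i) * (A $$ (i, j) * frame n l j)) *\<^sub>R (frame n k a * qcnj (frame n l b)))
      = (if b = j then if a = i then 4 *\<^sub>R A $$ (i, j) else 0 else 0)"
    proof (cases "i = 0 \<or> j = 0")
      case True
      then have "A $$ (i, j) = 0" using A0 A0' ij by auto
      then show ?thesis by simp
    next
      case False
      \<comment> \<open>Summing over \<open>k\<close> first leaves
        \<open>A $$ (i, j) * frame n l j\<close> when \<open>a = i\<close>; the sum over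
        \<open>l\<close> then yields the factor 4.\<close>
      have "(\<Sum>k<?N. \<Sum>l<?N.
          qRe (qcnj (frame n k i) * (A $$ (i, j) * frame n l j)) *\<^sub>R (frame n k a * qcnj (frame n l b)))
        = (\<Sum>l<?N. (\<Sum>k<?N. qRe (qcnj (frame n k i) * (A $$ (i, j) * frame n l j)) *\<^sub>R frame n k a)
            * qcnj (frame n l b))"
        by (subst sum.swap) (simp add: sum_distrib_right del: sum.lessThan_Suc)
      also have "\<dots> = (\<Sum>l<?N. (if a = i then A $$ (i, j) * frame n l j else 0) * qcnj (frame n l b))"
        using False ij ab by (intro sum.cong refl arg_cong2[where f = times] frame_expansion) auto
      also have "\<dots> = (if a = i then A $$ (i, j) * (\<Sum>l<?N. frame n l j * qcnj (frame n l b)) else 0)"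
        by (simp add: sum_distrib_left mult.assoc del: sum.lessThan_Suc)
      also have "\<dots> = (if b = j then if a = i then 4 *\<^sub>R A $$ (i, j) else 0 else 0)"
        using False ij ab
        by (subst frame_orthogonal) auto
      finally show ?thesis .
    qed
  qed
  also have "\<dots> = 4 *\<^sub>R A $$ (a, b)"
    using ab by (simp del: sum.lessThan_Suc)
  finally show ?thesis .
qed

section \<open>Schur complement and semidefinite preimages\<close>

text \<open>The form of the Schur complement at \<open>w\<close> is that of \<open>Z\<close> at the vector obtained from \<open>w\<close> by
  the change of entry 0 that minimizes it.\<close>

lemma schur_complement_psd:
  fixes Z :: "quat mat"
  assumes Z: "qpsd (n + 1) Z" and Z00: "Z $$ (0, 0) = 1"
  shows "qpsd (n + 1) (mat (n + 1) (n + 1) (\<lambda>(i, j). Z $$ (i, j) - Z $$ (i, 0) * Z $$ (0, j)))"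
    (is "qpsd _ ?S")
proof -
  let ?M = "n + 1"
  have h: "Z \<in> hermitian_mats ?M" using Z by (simp add: qpsd_def)
  have Zc: "Z \<in> carrier_mat ?M ?M" using h by (simp add: hermitian_mats_def)
  have Sc: "?S \<in> carrier_mat ?M ?M" by simp
  have "?S \<in> hermitian_mats ?M"
    unfolding hermitian_mats_def
    by (auto simp: qadjoint_def qcnj_diff qcnj_mult hermitian_entry[OF h] intro!: eq_matI)
  moreover have "0 \<le> qform ?S w" if w: "w \<in> carrier_vec ?M" for w
  proof -
    \<comment> \<open>\<open>c\<close> is entry 0 of \<open>Z w\<close>. Since
      \<open>Z $$ (0, 0) = 1\<close>, subtracting \<open>c\<close> from entry 0 of \<open>w\<close>
      makes entry 0 of the product with \<open>Z\<close> vanish.\<close>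
    define c where "c = (\<Sum>j<?M. Z $$ (0, j) * w $ j)"
    define d :: "nat \<Rightarrow> quat" where "d i = (if i = 0 then c else 0)" for i
    have cc: "qcnj c = (\<Sum>i<?M. qcnj (w $ i) * Z $$ (i, 0))"
      by (simp add: c_def qcnj_sum qcnj_mult hermitian_entry[OF h] del: sum.lessThan_Suc)
    have wd: "(\<Sum>i<?M. \<Sum>j<?M. qcnj (w $ i) * Z $$ (i, j) * d j) = qcnj c * c"
    proof -
      have "(\<Sum>j<?M. qcnj (w $ i) * Z $$ (i, j) * d j) = qcnj (w $ i) * Z $$ (i, 0) * c" for i
        by (simp add: d_def if_distrib[of "times _"] cong: if_cong del: sum.lessThan_Suc)
      then show ?thesis by (simp only: cc sum_distrib_right)
    qed
    have dx: "(\<Sum>i<?M. \<Sum>j<?M. qcnj (d i) * Z $$ (i, j) * x j) =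
        qcnj c * (\<Sum>j<?M. Z $$ (0, j) * x j)" for x
    proof -
      have "(\<Sum>i<?M. \<Sum>j<?M. qcnj (d i) * Z $$ (i, j) * x j) =
          (\<Sum>i<?M. if i = 0 then qcnj c * (\<Sum>j<?M. Z $$ (0, j) * x j) else 0)"
        by (intro sum.cong refl) (simp add: d_def sum_distrib_left mult.assoc del: sum.lessThan_Suc)
      also have "\<dots> = qcnj c * (\<Sum>j<?M. Z $$ (0, j) * x j)" by (simp del: sum.lessThan_Suc)
      finally show ?thesis .
    qed
    have Zd: "(\<Sum>j<?M. Z $$ (0, j) * d j) = c"
      by (simp add: d_def Z00 if_distrib[of "times _"] cong: if_cong del: sum.lessThan_Suc)
    have "qform Z (vec ?M (\<lambda>i. w $ i - d i)) =
        (\<Sum>i<?M. \<Sum>j<?M. qcnj (w $ i - d i) * Z $$ (i, j) * (w $ j - d j))"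
      by (subst qform_sum[OF Zc]) (auto intro!: sum.cong)
    also have "\<dots> = (\<Sum>i<?M. \<Sum>j<?M. qcnj (w $ i) * Z $$ (i, j) * w $ j)
        - (\<Sum>i<?M. \<Sum>j<?M. qcnj (w $ i) * Z $$ (i, j) * d j)
        - (\<Sum>i<?M. \<Sum>j<?M. qcnj (d i) * Z $$ (i, j) * w $ j)
        + (\<Sum>i<?M. \<Sum>j<?M. qcnj (d i) * Z $$ (i, j) * d j)"
      unfolding sum_subtractf[symmetric] sum.distrib[symmetric]
      by (intro sum.cong refl) (simp add: qcnj_diff algebra_simps)
    \<comment> \<open>Each of the three correction terms equals \<open>qcnj c * c\<close>; with
      signs -, -, + a single subtraction remains.\<close>
    also have "\<dots> = (\<Sum>i<?M. \<Sum>j<?M. qcnj (w $ i) * Z $$ (i, j) * w $ j) - qcnj c * c"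
      by (simp only: wd dx Zd c_def[symmetric]) simp
    also have "\<dots> = (\<Sum>i<?M. \<Sum>j<?M. qcnj (w $ i) * (Z $$ (i, j) - Z $$ (i, 0) * Z $$ (0, j)) * w $ j)"
      unfolding cc unfolding c_def sum_product sum_subtractf[symmetric]
      by (intro sum.cong refl) (simp add: algebra_simps)
    also have "\<dots> = qform ?S w"
      by (subst qform_sum[OF Sc w]) (auto intro!: sum.cong)
    finally have "qform ?S w = qform Z (vec ?M (\<lambda>i. w $ i - d i))" ..
    also have "0 \<le> \<dots>" using Z by (simp add: qpsd_def)
    finally show ?thesis .
  qed
  ultimately show ?thesis by (simp add: qpsd_def)
qed

lemma lift_surjective:
  assumes Z: "qpsd (n + 1) Z" and Z00: "Z $$ (0, 0) = 1"
  obtains Y where "rpsd (4 * n + 1) Y" "lift n Y = Z"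
proof -
  let ?N = "4 * n + 1" and ?M = "n + 1"
  have h: "Z \<in> hermitian_mats ?M" using Z by (simp add: qpsd_def)
  have Zc: "Z \<in> carrier_mat ?M ?M" using h by (simp add: hermitian_mats_def)
  define S where "S = mat ?M ?M (\<lambda>(i, j). Z $$ (i, j) - Z $$ (i, 0) * Z $$ (0, j))"
  have S: "qpsd ?M S" unfolding S_def by (rule schur_complement_psd[OF Z Z00])
  then have Sh: "S \<in> hermitian_mats ?M" by (simp add: qpsd_def)
  have Gs: "Gamma n S \<in> symmetric_mats ?N" by (rule Gamma_symmetric[OF Sh])
  have Gc: "Gamma n S \<in> carrier_mat ?N ?N" using Gs by (simp add: symmetric_mats_def)
  \<comment> \<open>Real coordinates of column 0 of \<open>Z\<close>: block \<open>s\<close> of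
    length \<open>n\<close> starts at index \<open>(s - 1) * n + 1\<close>, and the leading 1 is
    \<open>Z $$ (0, 0)\<close>.\<close>
  define v where "v = vec ?N (\<lambda>k. if k = 0 then 1 else if k \<le> n then qRe (Z $$ (k, 0))
    else if k \<le> 2 * n then qI (Z $$ (k - n, 0)) else if k \<le> 3 * n then qJ (Z $$ (k - 2 * n, 0))
    else qK (Z $$ (k - 3 * n, 0)))"
  have tv: "tau n v $ a = Z $$ (a, 0)" if "a < ?M" for a
    using that by (auto simp: tau_def v_def Z00 quat_eq_iff)
  define Y where "Y = mat ?N ?N (\<lambda>(k, l). v $ k * v $ l + Gamma n S $$ (k, l) / 4)"
  have Yc: "Y \<in> carrier_mat ?N ?N" by (simp add: Y_def)
  have "Y \<in> symmetric_mats ?N"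
    unfolding symmetric_mats_def Y_def
    by (auto simp: symmetric_entry[OF Gs] intro!: eq_matI)
  moreover have "0 \<le> rform Y w" if w: "w \<in> carrier_vec ?N" for w
  proof -
    have "rform Y w = (\<Sum>i<?N. \<Sum>j<?N. w $ i * (v $ i * v $ j + Gamma n S $$ (i, j) / 4) * w $ j)"
      by (subst rform_sum[OF Yc w]) (auto simp: Y_def intro!: sum.cong)
    \<comment> \<open>The rank-one part contributes a square, the other part a quarter of the form
      of \<open>S\<close> at \<open>tau n w\<close>.\<close>
    also have "\<dots> = (\<Sum>i<?N. w $ i * v $ i) * (\<Sum>j<?N. w $ j * v $ j) + rform (Gamma n S) w / 4"
      unfolding rform_sum[OF Gc w] sum_product sum_divide_distrib sum.distrib[symmetric]
      by (intro sum.cong refl) (simp add: algebra_simps)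
    also have "rform (Gamma n S) w = qRe (qform S (tau n w))"
      using Gamma_form[OF Sh w] by (metis quat_of_real_sel(1))
    also have "(\<Sum>i<?N. w $ i * v $ i) * (\<Sum>j<?N. w $ j * v $ j) + qRe (qform S (tau n w)) / 4 \<ge> 0"
    proof -
      have "0 \<le> qform S (tau n w)" using S tau_carrier by (auto simp: qpsd_def)
      then show ?thesis by (simp add: less_eq_quat_def del: sum.lessThan_Suc)
    qed
    finally show ?thesis .
  qed
  ultimately have "rpsd ?N Y" by (simp add: rpsd_def)
  moreover have "lift n Y = Z"
  proof (rule eq_matI)
    fix a b assume "a < dim_row Z" "b < dim_col Z"
    then have ab: "a < ?M" "b < ?M" using Zc by auto
    have "lift n Y $$ (a, b) = (\<Sum>k<?N. \<Sum>l<?N.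
        (v $ k * v $ l + Gamma n S $$ (k, l) / 4) *\<^sub>R (frame n k a * qcnj (frame n l b)))"
      using ab by (simp add: lift_def Y_def del: sum.lessThan_Suc)
    also have "\<dots> = (\<Sum>k<?N. (v $ k) *\<^sub>R frame n k a) * qcnj (\<Sum>l<?N. (v $ l) *\<^sub>R frame n l b)
        + (1 / 4) *\<^sub>R lift n (Gamma n S) $$ (a, b)"
      unfolding qcnj_sum sum_product
      using ab by (simp add: lift_def scaleR_sum_right scaleR_add_left qcnj_scaleR sum.distrib mult.commute
          del: sum.lessThan_Suc)
    also have "\<dots> = Z $$ (a, 0) * qcnj (Z $$ (b, 0)) + S $$ (a, b)"
    proof -
      \<comment> \<open>Row 0 of \<open>S\<close> vanishes because
        \<open>Z $$ (0, 0) = 1\<close>.\<close>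
      have "lift n (Gamma n S) $$ (a, b) = 4 *\<^sub>R S $$ (a, b)"
        using ab by (intro lift_Gamma[OF Sh]) (auto simp: S_def Z00)
      then show ?thesis using ab by (simp only: tau_frame[symmetric] tv) simp
    qed
    also have "\<dots> = Z $$ (a, b)"
      using ab by (simp add: S_def hermitian_entry[OF h])
    finally show "lift n Y $$ (a, b) = Z $$ (a, b)" .
  qed (use Zc in \<open>auto simp: lift_def\<close>)
  ultimately show ?thesis by (rule that)
qed

section \<open>Equality of the optimal values\<close>

theorem theorem6p9:
  fixes n m l :: nat
    and F :: "quat mat" and G H :: "nat \<Rightarrow> quat mat"
  assumes "F \<in> hermitian_mats (n + 1)"
    and "\<forall>i\<in>{1..m}. G i \<in> hermitian_mats (n + 1)"
    and "\<forall>j\<in>{1..l}. H j \<in> hermitian_mats (n + 1)"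
  shows "quat_moment_value n m l F G H =
    real_moment_value (4 * n) m l (Gamma n F) (\<lambda>i. Gamma n (G i)) (\<lambda>j. Gamma n (H j))"
proof -
  let ?Q = "quat_moment_feasible n m l G H"
  let ?R = "real_moment_feasible (4 * n) m l (\<lambda>i. Gamma n (G i)) (\<lambda>j. Gamma n (H j))"
  \<comment> \<open>For semidefinite \<open>Y\<close> both semidefiniteness constraints hold;
    adjointness matches the linear constraints and \<open>lift_00\<close> the normalization.\<close>
  have iff: "lift n Y \<in> ?Q \<longleftrightarrow> Y \<in> ?R" if Y: "rpsd (4 * n + 1) Y" for Y
  proof -
    have sym: "Y \<in> symmetric_mats (4 * n + 1)" using Y by (simp add: rpsd_def)
    have "lift n Y $$ (0, 0) = 1 \<longleftrightarrow> Y $$ (0, 0) = 1" by (simp add: lift_00)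
    then show ?thesis
      using assms(2,3) Y sym lift_psd[OF Y] lift_hermitian[OF sym]
      by (simp add: quat_moment_feasible_def real_moment_feasible_def rinner_Gamma)
  qed
  have obj: "rinner (Gamma n F) Y = qinner F (lift n Y)" if "rpsd (4 * n + 1) Y" for Y
    using that by (intro rinner_Gamma[OF assms(1)]) (simp add: rpsd_def)
  show ?thesis
    unfolding quat_moment_value_def real_moment_value_def
  \<comment> \<open>Matching each feasible point with one of no larger objective on the other side
    suffices, so neither attainment nor finiteness of the infima enters.\<close>
  proof (rule INF_eq)
    fix Z assume Z: "Z \<in> ?Q"
    then obtain Y where "rpsd (4 * n + 1) Y" "lift n Y = Z"
      using lift_surjective[of n Z] by (auto simp: quat_moment_feasible_def)
    with Z show "\<exists>Y\<in>?R. ereal (rinner (Gamma n F) Y) \<le> ereal (qinner F Z)"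
      using iff obj by (intro bexI[of _ Y]) auto
  next
    fix Y assume Y: "Y \<in> ?R"
    then have "rpsd (4 * n + 1) Y" by (simp add: real_moment_feasible_def)
    with Y show "\<exists>Z\<in>?Q. ereal (qinner F Z) \<le> ereal (rinner (Gamma n F) Y)"
      using iff obj by (intro bexI[of _ "lift n Y"]) auto
  qed
qed

end
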